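(* Let $n,k,p,m'\ge1$ be integers with $m'k$ even, put $m=pm'$, and let $M=(M_{j_1,\dots,j_{m'k}})_{1\le j_1,\dots,j_{m'k}\le mn}$ be a tensor of order $m'k$ with entries in a commutative $\mathbb{Q}$-algebra. Then $$\mathtt{PF}^{(m)}\Big(\mathtt{PF}^{(m')}\big(M\langle i_1,\dots,i_{mk}\rangle\big)\Big)_{1\le i_1,\dots,i_{mk}\le mn}=\frac{1}{n!}\binom{np}{p,\dots,p}\,\mathtt{PF}^{(m')}(M),$$ where $\binom{np}{p,\dots,p}=\frac{(np)!}{(p!)^n}$ and $$M\langle i_1,\dots,i_{mk}\rangle=M\big[\underbrace{\{i_1,\dots,i_m\}|\cdots|\{i_1,\dots,i_m\}}_{m'\text{ times}}|\cdots|\underbrace{\{i_{m(k-1)+1},\dots,i_{mk}\}|\cdots|\{i_{m(k-1)+1},\dots,i_{mk}\}}_{m'\text{ times}}\big].$$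
   Context: Hyperpfaffian. For integers $d,N,k\ge1$ and a tensor $T=(T_{i_1,\dots,i_{dk}})_{1\le i_1,\dots,i_{dk}\le dN}$ of order $dk$, $$\mathtt{PF}^{(d)}(T):=\frac1{N!}\sum \epsilon(\sigma_1)\cdots\epsilon(\sigma_k)\prod_{i=1}^N T_{\sigma_1((i-1)d+1),\dots,\sigma_1(id),\,\dots,\,\sigma_k((i-1)d+1),\dots,\sigma_k(id)},$$ where the sum runs over all $k$-tuples $(\sigma_1,\dots,\sigma_k)$ of permutations of $\{1,\dots,dN\}$ such that $\sigma_j((i-1)d+1)<\cdots<\sigma_j(id)$ for all $1\le j\le k$, $1\le i\le N$, and $\epsilon$ is the signature. Thus $\mathtt{PF}^{(m')}(M)$ uses $d=m'$, $N=pn$; each $\mathtt{PF}^{(m')}(M\langle i_1,\dots,i_{mk}\rangle)$ uses $d=m'$, $N=p$; and the outer $\mathtt{PF}^{(m)}$ uses $d=m$, $N=n$, applied to the tensor of order $mk$ whose $(i_1,\dots,i_{mk})$ entry is $\mathtt{PF}^{(m')}(M\langle i_1,\dots,i_{mk}\rangle)$. Hyperminors. For subsets $I_1,\dots,I_{m'k}$ of $\{1,\dots,mn\}$ of the same cardinality $c$, $M[I_1|\cdots|I_{m'k}]$ is the tensor obtained from $M$ by keeping the entries whose $t$-th index lies in $I_t$ for each $t$, each $I_t$ being reindexed by $\{1,\dots,c\}$ in increasing order. The outer hyperpfaffian only involves entries with $i_{(s-1)m+1}<\cdots<i_{sm}$ for every $1\le s\le k$, for which each set $\{i_{(s-1)m+1},\dots,i_{sm}\}$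 has cardinality $m=pm'$; the entries at other index tuples are irrelevant and may be given arbitrary values (e.g. $0$). *)

theory Defs
  imports Complex_Main "HOL-Library.FuncSet" "HOL-Combinatorics.Permutations"
begin

locale comm_rat_algebra = vector_space scale
  for scale :: "rat \<Rightarrow> 'a::comm_ring_1 \<Rightarrow> 'a" +
  assumes scale_mult_left: "scale q (x * y) = scale q x * y"

text \<open>
  A tensor of order \<open>r\<close> is a function on index lists; only its values on lists of length \<open>r\<close>
  matter. Tensor indices, blocks and tuple positions are counted from 1 throughout, so the
  \<open>t\<close>-th entry of an index list \<open>l\<close> is \<open>l ! (t - 1)\<close>.
\<close>

type_synonym 'a tensor = "nat list \<Rightarrow> 'a"

definition block_increasing_perms :: "nat \<Rightarrow> nat \<Rightarrow> (nat \<Rightarrow> nat) set" where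
  "block_increasing_perms d N =
    {\<sigma>. \<sigma> permutes {1..d * N} \<and> (\<forall>i\<in>{1..N}. strict_mono_on {(i - 1) * d + 1..i * d} \<sigma>)}"

definition hyperpfaffian ::
  "(rat \<Rightarrow> 'a::comm_ring_1 \<Rightarrow> 'a) \<Rightarrow> nat \<Rightarrow> nat \<Rightarrow> nat \<Rightarrow> 'a tensor \<Rightarrow> 'a" where
  "hyperpfaffian scale d N k T =
    scale (1 / fact N)
      (\<Sum>\<sigma> \<in> {1..k} \<rightarrow>\<^sub>E block_increasing_perms d N.
        (\<Prod>j=1..k. of_int (sign (\<sigma> j))) *
        (\<Prod>i=1..N. T (concat (map (\<lambda>j. map (\<sigma> j) [(i - 1) * d + 1..<i * d + 1]) [1..<k + 1]))))"

text \<open>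
  For \<open>Is = [I\<^sub>1, \<dots>, I\<^sub>r]\<close> this is \<open>M[I\<^sub>1|\<cdots>|I\<^sub>r]\<close>: the entry at \<open>[j\<^sub>1, \<dots>, j\<^sub>r]\<close> is the entry of \<open>M\<close>
  whose \<open>t\<close>-th index is the \<open>j\<^sub>t\<close>-th smallest element of \<open>I\<^sub>t\<close>.
\<close>

definition hyperminor :: "'a tensor \<Rightarrow> nat set list \<Rightarrow> 'a tensor" where
  "hyperminor M Is = (\<lambda>js. M (map2 (\<lambda>I j. sorted_list_of_set I ! (j - 1)) Is js))"

text \<open>\<open>M\<langle>i\<^sub>1, \<dots>, i\<^bsub>mk\<^esub>\<rangle>\<close> for \<open>l = [i\<^sub>1, \<dots>, i\<^bsub>mk\<^esub>]\<close>, with \<open>m'\<close> copies of each set.\<close>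

definition block_hyperminor :: "nat \<Rightarrow> nat \<Rightarrow> nat \<Rightarrow> 'a tensor \<Rightarrow> nat list \<Rightarrow> 'a tensor" where
  "block_hyperminor m' m k M l =
    hyperminor M
      (concat (map (\<lambda>s. replicate m' ((\<lambda>t. l ! (t - 1)) ` {(s - 1) * m + 1..s * m})) [1..<k + 1]))"

end

theory Submission
  imports Defs
begin

text \<open>
  Splitting \<open>{1..m * n}\<close> into \<open>n\<close> consecutive blocks of length \<open>m = p * m'\<close> and each of these into
  \<open>p\<close> sub-blocks of length \<open>m'\<close> gives \<open>p * n\<close> blocks of length \<open>m'\<close>. The permutations that increase
  on the long blocks represent the left cosets of the Young subgroup \<open>S\<^sub>m \<times> \<cdots> \<times> S\<^sub>m\<close>, so every
  permutation is uniquely \<open>\<sigma> \<circ> (\<tau>\<^sub>1 \<oplus> \<cdots> \<oplus> \<tau>\<^sub>n)\<close> with \<open>\<sigma>\<close> increasing on long blocks and each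
  \<open>\<tau>\<^sub>i\<close> a permutation of \<open>{1..m}\<close> (\<open>factorisation_exists\<close>, \<open>factorisation_unique\<close>). Since \<open>\<sigma>\<close>
  preserves the order inside a long block, the composite increases on all short blocks exactly when
  every \<open>\<tau>\<^sub>i\<close> does (\<open>block_increasing_refinement_iff\<close>). Hence composition is a bijection
  from the index data of one outer and \<open>n\<close> inner hyperpfaffians to the index data of the large one,
  for each of the \<open>k\<close> permutations separately (\<open>bij_betw_block_refinement\<close>) and then for
  \<open>k\<close>-tuples (\<open>bij_betw_tuples_of_families\<close>).

  The bijection respects the summands (\<open>pfaffian_term_refinement\<close>). The sign of the composite is the
  product of the signs. The hyperminor of the \<open>i\<close>-th long block looks up the \<open>\<tau>\<^sub>i(t)\<close>-th smallest
  element of the set of values of \<open>\<sigma>\<close> on that block; as \<open>\<sigma>\<close> increases there, this element is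
  \<open>\<sigma>((i - 1) * m + \<tau>\<^sub>i(t))\<close>, which is the value of the composite at \<open>(i - 1) * m + t\<close>.
  So expanding the product of the \<open>n\<close> inner sums turns the left-hand side into the sum for the large
  hyperpfaffian, and only the normalising factors \<open>1 / n! * (1 / p!)\<^sup>n\<close> and \<open>1 / (p * n)!\<close>
  have to be compared.
\<close>

section \<open>Blocks and direct sums of permutations\<close>

text \<open>
  Parametrising a block by \<open>{1..d}\<close> makes the condition on \<open>\<sigma>\<close> comparable with the condition on
  permutations of \<open>{1..d}\<close>.
\<close>

lemma block_increasing_perms_iff:
  "\<sigma> \<in> block_increasing_perms d N \<longleftrightarrow>
    \<sigma> permutes {1..d * N} \<and> (\<forall>i\<in>{1..N}. strict_mono_on {1..d} (\<lambda>t. \<sigma> ((i - 1) * d + t)))"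
proof -
  have "strict_mono_on {(i - 1) * d + 1..i * d} \<sigma> \<longleftrightarrow> strict_mono_on {1..d} (\<lambda>t. \<sigma> ((i - 1) * d + t))"
    if "i \<in> {1..N}" for i
  proof -
    have id: "i * d = (i - 1) * d + d"
      using that by (cases i) auto
    show ?thesis
    proof
      assume R: "strict_mono_on {1..d} (\<lambda>t. \<sigma> ((i - 1) * d + t))"
      show "strict_mono_on {(i - 1) * d + 1..i * d} \<sigma>"
      proof (rule strict_mono_onI)
        fix r s
        assume "r \<in> {(i - 1) * d + 1..i * d}" "s \<in> {(i - 1) * d + 1..i * d}" "r < s"
        then show "\<sigma> r < \<sigma> s"
          using strict_mono_onD[OF R, of "r - (i - 1) * d" "s - (i - 1) * d"] by (auto simp: id)
      qed
    qed (auto simp: strict_mono_on_def id)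
  qed
  then show ?thesis
    by (auto simp: block_increasing_perms_def)
qed

lemma finite_block_increasing_perms: "finite (block_increasing_perms d N)"
  by (rule finite_subset[OF _ finite_permutations[of "{1..d * N}"]])
     (auto simp: block_increasing_perms_def)

lemma block_position_cases:
  fixes x :: nat
  assumes "x \<in> {1..n * m}"
  obtains i t where "i \<in> {1..n}" "t \<in> {1..m}" "x = (i - 1) * m + t"
proof
  have m: "m > 0"
    using assms by (cases m) auto
  have "(x - 1) div m < n"
    using assms m by (auto simp: less_mult_imp_div_less)
  then show "(x - 1) div m + 1 \<in> {1..n}" by simp
  show "(x - 1) mod m + 1 \<in> {1..m}"
    using m by (simp add: Suc_leI)
  show "x = ((x - 1) div m + 1 - 1) * m + ((x - 1) mod m + 1)"
    using assms by (simp add: div_mult_mod_eq)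
qed

lemma block_position_bounds:
  fixes i t m n :: nat
  assumes "i \<in> {1..n}" "t \<in> {1..m}"
  shows "(i - 1) * m + t \<in> {1..n * m}"
proof -
  have "(i - 1) * m + t \<le> (i - 1) * m + m" using assms by simp
  also have "\<dots> = i * m" using assms by (cases i) auto
  also have "\<dots> \<le> n * m" using assms by simp
  finally show ?thesis using assms by simp
qed

text \<open>
  The direct sum \<open>\<tau>\<^sub>1 \<oplus> \<cdots> \<oplus> \<tau>\<^sub>n\<close>: the \<open>i\<close>-th block of length \<open>m\<close> is permuted by a shifted copy
  of \<open>\<tau> i\<close>. Building it as a product of such copies makes the sign multiplicative by induction.
\<close>

primrec block_sum :: "nat \<Rightarrow> (nat \<Rightarrow> nat \<Rightarrow> nat) \<Rightarrow> nat \<Rightarrow> nat \<Rightarrow> nat" where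
  "block_sum m \<tau> 0 = id"
| "block_sum m \<tau> (Suc n) = block_sum m \<tau> n \<circ> map_permutation {1..m} (\<lambda>x. n * m + x) (\<tau> (Suc n))"

lemma shifted_block_permutes:
  fixes m n :: nat
  assumes "\<pi> permutes {1..m}"
  shows "map_permutation {1..m} (\<lambda>x. n * m + x) \<pi> permutes {n * m + 1..n * m + m}"
proof (rule map_permutation_permutes[OF _ assms])
  show "bij_betw ((+) (n * m)) {1..m} {n * m + 1..n * m + m}"
    by (auto simp: bij_betw_def)
qed

lemma block_sum_permutes:
  assumes "\<And>i. i \<in> {1..n} \<Longrightarrow> \<tau> i permutes {1..m}"
  shows "block_sum m \<tau> n permutes {1..n * m}"
  using assms
proof (induction n)
  case (Suc n)
  have "block_sum m \<tau> n permutes {1..n * m}"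
    using Suc by simp
  then have "block_sum m \<tau> n permutes {1..Suc n * m}"
    by (rule permutes_subset) auto
  moreover have "map_permutation {1..m} (\<lambda>x. n * m + x) (\<tau> (Suc n)) permutes {1..Suc n * m}"
    using Suc.prems
    by (intro permutes_subset[OF shifted_block_permutes]) auto
  ultimately show ?case
    by (simp add: permutes_compose del: o_apply)
qed simp

lemma block_sum_apply:
  assumes "\<And>i. i \<in> {1..n} \<Longrightarrow> \<tau> i permutes {1..m}" and "i \<in> {1..n}" "t \<in> {1..m}"
  shows "block_sum m \<tau> n ((i - 1) * m + t) = (i - 1) * m + \<tau> i t"
  using assms
proof (induction n)
  case (Suc n)
  have inj: "inj_on (\<lambda>x. n * m + x) {1..m}"
    by (auto simp: inj_on_def)
  show ?case
  proof (cases "i = Suc n")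
    case True
    have "\<tau> i t \<in> {1..m}"
      using Suc.prems by (metis permutes_in_image)
    moreover have "block_sum m \<tau> n permutes {1..n * m}"
      using Suc.prems by (intro block_sum_permutes) auto
    ultimately have "block_sum m \<tau> n (n * m + \<tau> i t) = n * m + \<tau> i t"
      by (intro permutes_not_in[of _ "{1..n * m}"]) auto
    then show ?thesis
      using map_permutation_apply[OF inj Suc.prems(3), of "\<tau> i"] True by simp
  next
    case False
    then have i: "i \<in> {1..n}" using Suc.prems by auto
    have "(i - 1) * m + t \<notin> {n * m + 1..n * m + m}"
      using block_position_bounds[OF i Suc.prems(3)] by auto
    then have "map_permutation {1..m} (\<lambda>x. n * m + x) (\<tau> (Suc n)) ((i - 1) * m + t) = (i - 1) * m + t"
      using shifted_block_permutes[OF Suc.prems(1)[of "Suc n"], of n] by (auto intro: permutes_not_in)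
    then show ?thesis
      using Suc.IH[OF Suc.prems(1) i Suc.prems(3)] by simp
  qed
qed simp

lemma sign_block_sum:
  assumes "\<And>i. i \<in> {1..n} \<Longrightarrow> \<tau> i permutes {1..m}"
  shows "sign (block_sum m \<tau> n) = (\<Prod>i=1..n. sign (\<tau> i))"
  using assms
proof (induction n)
  case (Suc n)
  have "permutation (block_sum m \<tau> n)"
    using block_sum_permutes[of n \<tau> m] Suc.prems by (intro permutes_imp_permutation) auto
  moreover have "permutation (map_permutation {1..m} (\<lambda>x. n * m + x) (\<tau> (Suc n)))"
    using shifted_block_permutes[OF Suc.prems[of "Suc n"], of n]
    by (intro permutes_imp_permutation[of "{n * m + 1..n * m + m}"]) auto
  moreover have "sign (map_permutation {1..m} (\<lambda>x. n * m + x) (\<tau> (Suc n))) = sign (\<tau> (Suc n))"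
    using Suc.prems by (intro sign_map_permutation) (auto simp: inj_on_def)
  ultimately show ?case
    using Suc by (simp add: sign_compose del: o_apply)
qed simp

lemma block_sum_restrict: "block_sum m (restrict \<tau> {1..n}) n = block_sum m \<tau> n"
proof -
  have cong: "block_sum m \<tau>' n' = block_sum m \<tau> n'" if "\<And>i. i \<in> {1..n'} \<Longrightarrow> \<tau>' i = \<tau> i" for \<tau>' n'
    using that by (induction n') auto
  show ?thesis by (rule cong) simp
qed

lemma sorted_list_of_strict_mono_image:
  fixes f :: "nat \<Rightarrow> nat"
  assumes "strict_mono_on {1..m} f"
  shows "sorted_list_of_set (f ` {1..m}) = map f [1..<m + 1]"
proof -
  have "sorted_wrt (<) (map f [1..<m + 1])"
    using assms
    by (auto simp: sorted_wrt_map strict_mono_on_def simp del: upt_Suc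
        intro!: sorted_wrt_mono_rel[OF _ sorted_wrt_upt])
  moreover have "set (map f [1..<m + 1]) = f ` {1..m}"
    by (simp only: set_map set_upt atLeastLessThanSuc_atLeastAtMost Suc_eq_plus1[symmetric])
  ultimately show ?thesis
    by (metis sorted_list_of_set.idem_if_sorted_distinct strict_sorted_iff)
qed

lemma strict_mono_on_eq_if_image_eq:
  fixes f g :: "nat \<Rightarrow> nat"
  assumes "strict_mono_on {1..m} f" "strict_mono_on {1..m} g" "f ` {1..m} = g ` {1..m}" "t \<in> {1..m}"
  shows "f t = g t"
proof -
  have "map f [1..<m + 1] = map g [1..<m + 1]"
    using assms(1-3) by (metis sorted_list_of_strict_mono_image)
  moreover have "t \<in> set [1..<m + 1]"
    using assms(4) by auto
  ultimately show ?thesis by (meson map_eq_conv)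
qed

lemma inj_on_sorting_permutation:
  fixes f :: "nat \<Rightarrow> nat"
  assumes "inj_on f {1..m}"
  obtains \<pi> where "\<pi> permutes {1..m}" "strict_mono_on {1..m} (f \<circ> \<pi>)"
proof -
  define xs where "xs = sorted_list_of_set (f ` {1..m})"
  have len: "length xs = m" and set: "set xs = f ` {1..m}" and srt: "sorted_wrt (<) xs"
    using assms by (auto simp: xs_def card_image)
  define \<pi> where "\<pi> = (\<lambda>t. if t \<in> {1..m} then inv_into {1..m} f (xs ! (t - 1)) else t)"
  have mem: "xs ! (t - 1) \<in> f ` {1..m}" if "t \<in> {1..m}" for t
    using that len by (subst set[symmetric]) auto
  have f\<pi>: "f (\<pi> t) = xs ! (t - 1)" if "t \<in> {1..m}" for t
    using that mem[OF that] by (simp add: \<pi>_def f_inv_into_f)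
  have mono: "strict_mono_on {1..m} (f \<circ> \<pi>)"
    using f\<pi> len by (auto simp: strict_mono_on_def intro!: sorted_wrt_nth_less[OF srt])
  have "inj_on \<pi> {1..m}"
    using strict_mono_on_imp_inj_on[OF mono] by (rule inj_on_imageI2)
  moreover have "\<pi> ` {1..m} \<subseteq> {1..m}"
    using inv_into_into[OF mem] by (auto simp: \<pi>_def simp del: atLeastAtMost_iff)
  ultimately have "bij_betw \<pi> {1..m} {1..m}"
    by (simp add: bij_betw_def endo_inj_surj)
  then have "\<pi> permutes {1..m}"
    by (rule bij_imp_permutes) (auto simp: \<pi>_def)
  then show ?thesis
    using mono that by blast
qed

section \<open>Factorisation along blocks\<close>

text \<open>
  The direct sum maps each block onto itself, so the composite determines the set of values of \<open>\<sigma>\<close>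
  on each block. Being increasing there, \<open>\<sigma>\<close> is determined by these sets, and then \<open>\<tau>\<close> is
  recovered by cancelling the injective \<open>\<sigma>\<close>.
\<close>

lemma factorisation_unique:
  assumes "\<sigma> \<in> block_increasing_perms m n" "\<sigma>' \<in> block_increasing_perms m n"
    and "\<And>i. i \<in> {1..n} \<Longrightarrow> \<tau> i permutes {1..m}" "\<And>i. i \<in> {1..n} \<Longrightarrow> \<tau>' i permutes {1..m}"
    and eq: "\<sigma> \<circ> block_sum m \<tau> n = \<sigma>' \<circ> block_sum m \<tau>' n"
  shows "\<sigma> = \<sigma>'" and "\<And>i. i \<in> {1..n} \<Longrightarrow> \<tau> i = \<tau>' i"
proof -
  have pos: "\<sigma> ((i - 1) * m + \<tau> i t) = \<sigma>' ((i - 1) * m + \<tau>' i t)" if "i \<in> {1..n}" "t \<in> {1..m}" for i t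
    using fun_cong[OF eq, of "(i - 1) * m + t"] block_sum_apply[of n \<tau> m i t]
      block_sum_apply[of n \<tau>' m i t] assms(3,4) that by simp
  have agree: "\<sigma> ((i - 1) * m + t) = \<sigma>' ((i - 1) * m + t)" if it: "i \<in> {1..n}" "t \<in> {1..m}" for i t
  proof (rule strict_mono_on_eq_if_image_eq[OF _ _ _ it(2)])
    show "strict_mono_on {1..m} (\<lambda>t. \<sigma> ((i - 1) * m + t))"
      "strict_mono_on {1..m} (\<lambda>t. \<sigma>' ((i - 1) * m + t))"
      using assms(1,2) it(1) by (auto simp: block_increasing_perms_iff)
    have "(\<lambda>t. \<sigma> ((i - 1) * m + t)) ` \<tau> i ` {1..m} = (\<lambda>t. \<sigma>' ((i - 1) * m + t)) ` \<tau>' i ` {1..m}"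
      using pos[OF it(1)] unfolding image_image by (intro image_cong) auto
    then show "(\<lambda>t. \<sigma> ((i - 1) * m + t)) ` {1..m} = (\<lambda>t. \<sigma>' ((i - 1) * m + t)) ` {1..m}"
      by (simp only: permutes_image[OF assms(3)[OF it(1)]] permutes_image[OF assms(4)[OF it(1)]])
  qed
  have perm: "\<sigma> permutes {1..n * m}" "\<sigma>' permutes {1..n * m}"
    using assms(1,2) by (auto simp: block_increasing_perms_iff mult.commute)
  show \<sigma>: "\<sigma> = \<sigma>'"
  proof
    fix x
    show "\<sigma> x = \<sigma>' x"
    proof (cases "x \<in> {1..n * m}")
      case True
      then show ?thesis
        by (elim block_position_cases) (simp only: agree)
    qed (metis perm permutes_not_in)
  qed
  fix i assume i: "i \<in> {1..n}"
  show "\<tau> i = \<tau>' i"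
  proof
    fix t
    show "\<tau> i t = \<tau>' i t"
    proof (cases "t \<in> {1..m}")
      case True
      then show ?thesis
        using pos[OF i True] permutes_inj[OF perm(1)] by (simp add: \<sigma> inj_eq)
    qed (metis assms(3,4) i permutes_not_in)
  qed
qed

text \<open>
  Sorting the values of \<open>\<rho>\<close> within each block by a permutation \<open>\<pi>\<^sub>i\<close> of its positions produces
  \<open>\<sigma>\<close>, and the inverses of the \<open>\<pi>\<^sub>i\<close> undo the sorting.
\<close>

lemma factorisation_exists:
  assumes "\<rho> permutes {1..m * n}"
  obtains \<sigma> \<tau> where "\<sigma> \<in> block_increasing_perms m n" "\<And>i. i \<in> {1..n} \<Longrightarrow> \<tau> i permutes {1..m}"
    "\<rho> = \<sigma> \<circ> block_sum m \<tau> n"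
proof -
  have "\<exists>\<pi>. \<forall>i. \<pi> i permutes {1..m} \<and> strict_mono_on {1..m} ((\<lambda>t. \<rho> ((i - 1) * m + t)) \<circ> \<pi> i)"
  proof (intro choice allI)
    fix i
    have "inj_on (\<lambda>t. \<rho> ((i - 1) * m + t)) {1..m}"
      by (auto intro!: inj_onI dest: injD[OF permutes_inj[OF assms]])
    then show "\<exists>\<pi>. \<pi> permutes {1..m} \<and> strict_mono_on {1..m} ((\<lambda>t. \<rho> ((i - 1) * m + t)) \<circ> \<pi>)"
      by (rule inj_on_sorting_permutation) blast
  qed
  then obtain \<pi> where \<pi>: "\<And>i. \<pi> i permutes {1..m}"
    and mono: "\<And>i. strict_mono_on {1..m} ((\<lambda>t. \<rho> ((i - 1) * m + t)) \<circ> \<pi> i)"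
    by blast
  define \<tau> where "\<tau> = (\<lambda>i. inv (\<pi> i))"
  have \<tau>: "\<tau> i permutes {1..m}" for i
    using \<pi> by (simp add: \<tau>_def permutes_inv)
  show ?thesis
  proof
    have "block_sum m \<pi> n permutes {1..m * n}"
      using block_sum_permutes[of n \<pi> m] \<pi> by (simp add: mult.commute)
    then have "\<rho> \<circ> block_sum m \<pi> n permutes {1..m * n}"
      using assms by (rule permutes_compose)
    then show "\<rho> \<circ> block_sum m \<pi> n \<in> block_increasing_perms m n"
      using mono block_sum_apply[of n \<pi> m] \<pi>
      by (auto simp: block_increasing_perms_iff strict_mono_on_def)
    show "\<rho> = \<rho> \<circ> block_sum m \<pi> n \<circ> block_sum m \<tau> n"
    proof
      fix x
      have "block_sum m \<pi> n (block_sum m \<tau> n x) = x"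
      proof (cases "x \<in> {1..n * m}")
        case True
        then obtain i t where it: "i \<in> {1..n}" "t \<in> {1..m}" "x = (i - 1) * m + t"
          by (rule block_position_cases)
        have "\<tau> i t \<in> {1..m}"
          using it(2) permutes_in_image[OF \<tau>] by blast
        moreover have "\<pi> i (\<tau> i t) = t"
          using permutes_inverses(1)[OF \<pi>] by (simp add: \<tau>_def)
        ultimately show ?thesis
          using it \<pi> \<tau> by (simp add: block_sum_apply del: One_nat_def)
      next
        case False
        then show ?thesis
          using permutes_not_in[OF block_sum_permutes[of n \<pi> m]]
            permutes_not_in[OF block_sum_permutes[of n \<tau> m]] \<pi> \<tau>
          by (simp del: One_nat_def)
      qed
      then show "\<rho> x = (\<rho> \<circ> block_sum m \<pi> n \<circ> block_sum m \<tau> n) x" by simp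
    qed
  qed (rule \<tau>)
qed

text \<open>
  Sub-block \<open>h\<close> of block \<open>i\<close> is the short block with number \<open>(i - 1) * p + h\<close>; the truncated
  subtraction is harmless because \<open>h \<ge> 1\<close>.
\<close>

lemma sub_block_position:
  fixes i h d p :: nat
  assumes "h \<ge> 1"
  shows "((i - 1) * p + h - 1) * d + u = (i - 1) * (p * d) + ((h - 1) * d + u)"
  using assms by (cases h) (auto simp: algebra_simps)

text \<open>
  A short block lies inside a long one, its image under the direct sum stays there, and \<open>\<sigma>\<close>
  reflects and preserves the order of positions within the long block. So \<open>\<sigma>\<close> drops out of the
  comparison of two values.
\<close>

lemma block_increasing_refinement_iff:
  assumes \<sigma>: "\<sigma> \<in> block_increasing_perms (p * d) n"
    and \<tau>: "\<And>i. i \<in> {1..n} \<Longrightarrow> \<tau> i permutes {1..p * d}"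
  shows "\<sigma> \<circ> block_sum (p * d) \<tau> n \<in> block_increasing_perms d (p * n) \<longleftrightarrow>
    (\<forall>i\<in>{1..n}. \<tau> i \<in> block_increasing_perms d p)"
proof -
  let ?\<rho> = "\<sigma> \<circ> block_sum (p * d) \<tau> n"
  have perm: "?\<rho> permutes {1..d * (p * n)}"
    using permutes_compose[OF block_sum_permutes[of n \<tau> "p * d"], of \<sigma>] \<sigma> \<tau>
    by (simp add: block_increasing_perms_iff mult.commute mult.left_commute)
  have mono_iff: "strict_mono_on {1..d} (\<lambda>u. ?\<rho> (((i - 1) * p + h - 1) * d + u)) \<longleftrightarrow>
      strict_mono_on {1..d} (\<lambda>u. \<tau> i ((h - 1) * d + u))"
    if i: "i \<in> {1..n}" and h: "h \<in> {1..p}" for i h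
  proof -
    have val: "?\<rho> (((i - 1) * p + h - 1) * d + u) = \<sigma> ((i - 1) * (p * d) + \<tau> i ((h - 1) * d + u))"
      and ran: "\<tau> i ((h - 1) * d + u) \<in> {1..p * d}" if "u \<in> {1..d}" for u
    proof -
      have u: "(h - 1) * d + u \<in> {1..p * d}"
        using h that by (rule block_position_bounds)
      then show "\<tau> i ((h - 1) * d + u) \<in> {1..p * d}"
        using permutes_in_image[OF \<tau>[OF i]] by blast
      show "?\<rho> (((i - 1) * p + h - 1) * d + u) = \<sigma> ((i - 1) * (p * d) + \<tau> i ((h - 1) * d + u))"
        using block_sum_apply[of n \<tau> "p * d" i, OF \<tau> i u] h
        by (simp add: sub_block_position del: One_nat_def)
    qed
    have "strict_mono_on {1..p * d} (\<lambda>t. \<sigma> ((i - 1) * (p * d) + t))"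
      using \<sigma> i by (simp add: block_increasing_perms_iff)
    then have "\<sigma> ((i - 1) * (p * d) + s) < \<sigma> ((i - 1) * (p * d) + t) \<longleftrightarrow> s < t"
      if "s \<in> {1..p * d}" "t \<in> {1..p * d}" for s t
      using that by (rule strict_mono_on_less)
    then show ?thesis
      using val ran by (simp add: strict_mono_on_def del: atLeastAtMost_iff cong: conj_cong)
  qed
  have "?\<rho> \<in> block_increasing_perms d (p * n) \<longleftrightarrow>
      (\<forall>b\<in>{1..n * p}. strict_mono_on {1..d} (\<lambda>u. ?\<rho> ((b - 1) * d + u)))"
    using perm by (simp add: block_increasing_perms_iff mult.commute)
  also have "\<dots> \<longleftrightarrow> (\<forall>i\<in>{1..n}. \<forall>h\<in>{1..p}. strict_mono_on {1..d} (\<lambda>u. ?\<rho> (((i - 1) * p + h - 1) * d + u)))"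
    using block_position_bounds[of _ n _ p] by (metis block_position_cases)
  also have "\<dots> \<longleftrightarrow> (\<forall>i\<in>{1..n}. \<tau> i \<in> block_increasing_perms d p)"
    using mono_iff \<tau> by (simp add: block_increasing_perms_iff mult.commute)
  finally show ?thesis .
qed

lemma bij_betw_block_refinement:
  "bij_betw (\<lambda>(\<sigma>, \<tau>). \<sigma> \<circ> block_sum (p * d) \<tau> n)
    (block_increasing_perms (p * d) n \<times> ({1..n} \<rightarrow>\<^sub>E block_increasing_perms d p))
    (block_increasing_perms d (p * n))"
proof -
  let ?\<Phi> = "\<lambda>(\<sigma>, \<tau>). \<sigma> \<circ> block_sum (p * d) \<tau> n"
  let ?A = "block_increasing_perms (p * d) n \<times> ({1..n} \<rightarrow>\<^sub>E block_increasing_perms d p)"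
  have perm: "\<tau> i permutes {1..p * d}"
    if "\<tau> \<in> {1..n} \<rightarrow>\<^sub>E block_increasing_perms d p" "i \<in> {1..n}" for \<tau> i
    using PiE_mem[OF that] by (simp add: block_increasing_perms_iff mult.commute)
  have "inj_on ?\<Phi> ?A"
  proof (intro inj_onI, clarify)
    fix \<sigma> \<tau> \<sigma>' \<tau>'
    assume *: "\<sigma> \<in> block_increasing_perms (p * d) n" "\<sigma>' \<in> block_increasing_perms (p * d) n"
      "\<tau> \<in> {1..n} \<rightarrow>\<^sub>E block_increasing_perms d p" "\<tau>' \<in> {1..n} \<rightarrow>\<^sub>E block_increasing_perms d p"
      "\<sigma> \<circ> block_sum (p * d) \<tau> n = \<sigma>' \<circ> block_sum (p * d) \<tau>' n"
    note fact = factorisation_unique[OF *(1,2) perm[OF *(3)] perm[OF *(4)] *(5)]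
    show "\<sigma> = \<sigma>' \<and> \<tau> = \<tau>'"
      using fact(1) PiE_ext[OF *(3,4) fact(2)] by blast
  qed
  moreover have "?\<Phi> ` ?A = block_increasing_perms d (p * n)"
  proof (intro subset_antisym subsetI)
    fix \<rho> assume "\<rho> \<in> ?\<Phi> ` ?A"
    then show "\<rho> \<in> block_increasing_perms d (p * n)"
      using block_increasing_refinement_iff perm by fastforce
  next
    fix \<rho> assume \<rho>: "\<rho> \<in> block_increasing_perms d (p * n)"
    then have "\<rho> permutes {1..p * d * n}"
      by (simp add: block_increasing_perms_iff mult.commute mult.left_commute)
    then obtain \<sigma> \<tau> where st: "\<sigma> \<in> block_increasing_perms (p * d) n"
      "\<And>i. i \<in> {1..n} \<Longrightarrow> \<tau> i permutes {1..p * d}" "\<rho> = \<sigma> \<circ> block_sum (p * d) \<tau> n"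
      using factorisation_exists by metis
    then have "\<forall>i\<in>{1..n}. \<tau> i \<in> block_increasing_perms d p"
      using \<rho> block_increasing_refinement_iff by blast
    then have "(\<sigma>, restrict \<tau> {1..n}) \<in> ?A"
      using st(1) by auto
    moreover have "\<rho> = ?\<Phi> (\<sigma>, restrict \<tau> {1..n})"
      using st(3) by (simp only: block_sum_restrict prod.case)
    ultimately show "\<rho> \<in> ?\<Phi> ` ?A" by blast
  qed
  ultimately show ?thesis by (simp add: bij_betw_def)
qed


text \<open>
  Applying a bijection to each of the \<open>J\<close>-indexed arguments separately, where the second component
  is a family over \<open>I\<close>. The families are stored with the index \<open>i\<close> outermost, because expanding a
  product over \<open>i\<close> of sums over \<open>J\<close>-tuples yields them in that order; hence the transposition
  \<open>\<tau> i j\<close>. The extensional function spaces require the restrictions.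
\<close>

lemma bij_betw_tuples_of_families:
  fixes f :: "'a \<times> ('i \<Rightarrow> 'b) \<Rightarrow> 'c"
  assumes f: "bij_betw f (A \<times> (I \<rightarrow>\<^sub>E B)) C"
  shows "bij_betw (\<lambda>(\<sigma>, \<tau>). \<lambda>j\<in>J. f (\<sigma> j, \<lambda>i\<in>I. \<tau> i j))
    ((J \<rightarrow>\<^sub>E A) \<times> (I \<rightarrow>\<^sub>E (J \<rightarrow>\<^sub>E B))) (J \<rightarrow>\<^sub>E C)"
proof -
  define g where "g = inv_into (A \<times> (I \<rightarrow>\<^sub>E B)) f"
  have gf: "g (f x) = x" if "x \<in> A \<times> (I \<rightarrow>\<^sub>E B)" for x
    using f that by (simp add: g_def bij_betw_inv_into_left)
  have fg: "f (g y) = y" if "y \<in> C" for y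
    using f that by (simp add: g_def bij_betw_inv_into_right)
  have fC: "f x \<in> C" if "x \<in> A \<times> (I \<rightarrow>\<^sub>E B)" for x
    using f that by (rule bij_betwE[rule_format])
  have gA: "g y \<in> A \<times> (I \<rightarrow>\<^sub>E B)" if "y \<in> C" for y
    using bij_betw_inv_into[OF f] that unfolding g_def by (rule bij_betwE[rule_format])
  have row: "(\<sigma> j, \<lambda>i\<in>I. \<tau> i j) \<in> A \<times> (I \<rightarrow>\<^sub>E B)"
    if "\<sigma> \<in> J \<rightarrow>\<^sub>E A" "\<tau> \<in> I \<rightarrow>\<^sub>E (J \<rightarrow>\<^sub>E B)" "j \<in> J" for \<sigma> \<tau> j
    using that by (auto simp: PiE_iff)
  have snd_ext: "(\<lambda>i\<in>I. snd (g y) i) = snd (g y)" if "y \<in> C" for y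
    using gA[OF that] by (auto simp: PiE_def extensional_restrict)
  let ?F = "\<lambda>(\<sigma>, \<tau>). \<lambda>j\<in>J. f (\<sigma> j, \<lambda>i\<in>I. \<tau> i j)"
  let ?G = "\<lambda>\<rho>. (\<lambda>j\<in>J. fst (g (\<rho> j)), \<lambda>i\<in>I. \<lambda>j\<in>J. snd (g (\<rho> j)) i)"
  show ?thesis
  proof (rule bij_betw_byWitness[where f' = ?G])
    show "\<forall>x\<in>(J \<rightarrow>\<^sub>E A) \<times> (I \<rightarrow>\<^sub>E (J \<rightarrow>\<^sub>E B)). ?G (?F x) = x"
    proof
      fix x assume "x \<in> (J \<rightarrow>\<^sub>E A) \<times> (I \<rightarrow>\<^sub>E (J \<rightarrow>\<^sub>E B))"
      then obtain \<sigma> \<tau> where x: "x = (\<sigma>, \<tau>)" and st: "\<sigma> \<in> J \<rightarrow>\<^sub>E A" "\<tau> \<in> I \<rightarrow>\<^sub>E (J \<rightarrow>\<^sub>E B)"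
        by blast
      have "?G (?F x) = (\<lambda>j\<in>J. \<sigma> j, \<lambda>i\<in>I. \<lambda>j\<in>J. \<tau> i j)"
        by (simp add: x gf[OF row[OF st]] cong: restrict_cong)
      also have "(\<lambda>j\<in>J. \<sigma> j) = \<sigma>"
        using st(1) by (rule PiE_restrict)
      also have "(\<lambda>i\<in>I. \<lambda>j\<in>J. \<tau> i j) = (\<lambda>i\<in>I. \<tau> i)"
        by (rule restrict_ext) (rule PiE_restrict[OF PiE_mem[OF st(2)]])
      also have "\<dots> = \<tau>"
        using st(2) by (rule PiE_restrict)
      finally show "?G (?F x) = x"
        by (simp only: x)
    qed
    show "\<forall>\<rho>\<in>J \<rightarrow>\<^sub>E C. ?F (?G \<rho>) = \<rho>"
    proof
      fix \<rho> assume \<rho>: "\<rho> \<in> J \<rightarrow>\<^sub>E C"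
      have "?F (?G \<rho>) = (\<lambda>j\<in>J. \<rho> j)"
        by (simp add: snd_ext fg PiE_mem[OF \<rho>] cong: restrict_cong)
      also have "\<dots> = \<rho>"
        using \<rho> by (rule PiE_restrict)
      finally show "?F (?G \<rho>) = \<rho>" .
    qed
    show "?F ` ((J \<rightarrow>\<^sub>E A) \<times> (I \<rightarrow>\<^sub>E (J \<rightarrow>\<^sub>E B))) \<subseteq> J \<rightarrow>\<^sub>E C"
      using fC[OF row] by auto
    show "?G ` (J \<rightarrow>\<^sub>E C) \<subseteq> (J \<rightarrow>\<^sub>E A) \<times> (I \<rightarrow>\<^sub>E (J \<rightarrow>\<^sub>E B))"
    proof (rule image_subsetI)
      fix \<rho> assume \<rho>: "\<rho> \<in> J \<rightarrow>\<^sub>E C"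
      have g\<rho>: "fst (g (\<rho> j)) \<in> A" "snd (g (\<rho> j)) \<in> I \<rightarrow>\<^sub>E B" if "j \<in> J" for j
        using gA[OF PiE_mem[OF \<rho> that]] by (simp_all only: mem_Times_iff)
      show "?G \<rho> \<in> (J \<rightarrow>\<^sub>E A) \<times> (I \<rightarrow>\<^sub>E (J \<rightarrow>\<^sub>E B))"
        by (intro SigmaI restrict_PiE_iff[THEN iffD2] ballI g\<rho> PiE_mem[OF g\<rho>(2)])
    qed
  qed
qed

section \<open>Summands of a hyperpfaffian\<close>

text \<open>The index list at which the \<open>i\<close>-th factor of a summand evaluates the tensor.\<close>

definition block_word :: "nat \<Rightarrow> nat \<Rightarrow> (nat \<Rightarrow> nat \<Rightarrow> nat) \<Rightarrow> nat \<Rightarrow> nat list" where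
  "block_word k d \<sigma> i = concat (map (\<lambda>j. map (\<sigma> j) [(i - 1) * d + 1..<i * d + 1]) [1..<k + 1])"

definition pfaffian_term :: "nat \<Rightarrow> nat \<Rightarrow> nat \<Rightarrow> 'a::comm_ring_1 tensor \<Rightarrow> (nat \<Rightarrow> nat \<Rightarrow> nat) \<Rightarrow> 'a" where
  "pfaffian_term d N k T \<sigma> =
    (\<Prod>j=1..k. of_int (sign (\<sigma> j))) * (\<Prod>i=1..N. T (block_word k d \<sigma> i))"

lemma hyperpfaffian_eq_sum_terms:
  "hyperpfaffian scale d N k T =
    scale (1 / fact N) (\<Sum>\<sigma> \<in> {1..k} \<rightarrow>\<^sub>E block_increasing_perms d N. pfaffian_term d N k T \<sigma>)"
  by (simp add: hyperpfaffian_def pfaffian_term_def block_word_def)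

lemma map_block_positions:
  assumes "i \<ge> 1"
  shows "map f [(i - 1) * d + 1..<i * d + 1] = map (\<lambda>t. f ((i - 1) * d + t)) [1..<d + 1]"
  using assms by (cases i) (auto intro!: nth_equalityI simp del: upt_Suc simp: algebra_simps)

lemma block_word_eq:
  assumes "i \<ge> 1"
  shows "block_word k d \<sigma> i = concat (map (\<lambda>j. map (\<lambda>t. \<sigma> j ((i - 1) * d + t)) [1..<d + 1]) [1..<k + 1])"
  unfolding block_word_def map_block_positions[OF assms] ..

lemma nth_concat_uniform:
  assumes "\<And>xs. xs \<in> set xss \<Longrightarrow> length xs = m" "i < length xss" "t < m"
  shows "concat xss ! (i * m + t) = xss ! i ! t"
  using assms
proof (induction xss arbitrary: i)
  case (Cons xs xss)
  then show ?case
    by (cases i) (auto simp: nth_append)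
qed simp

lemma nth_map_from_one:
  assumes "t \<in> {1..N}"
  shows "map f [1..<N + 1] ! (t - 1) = f t"
proof -
  have "t - 1 < N" "1 + (t - 1) = t"
    using assms by auto
  then show ?thesis
    by (simp del: upt_Suc)
qed

lemma nth_block_word:
  assumes "i \<ge> 1" "s \<in> {1..k}" "t \<in> {1..d}"
  shows "block_word k d \<sigma> i ! ((s - 1) * d + t - 1) = \<sigma> s ((i - 1) * d + t)"
proof -
  have "block_word k d \<sigma> i ! ((s - 1) * d + (t - 1)) =
      map (\<lambda>j. map (\<lambda>t. \<sigma> j ((i - 1) * d + t)) [1..<d + 1]) [1..<k + 1] ! (s - 1) ! (t - 1)"
    unfolding block_word_eq[OF assms(1)]
    by (rule nth_concat_uniform) (use assms in auto)
  then show ?thesis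
    using assms by (auto simp: nth_map_from_one simp del: upt_Suc)
qed

lemma map2_concat:
  assumes "\<And>x. x \<in> set xs \<Longrightarrow> length (A x) = length (B x)"
  shows "map2 f (concat (map A xs)) (concat (map B xs)) = concat (map (\<lambda>x. map2 f (A x) (B x)) xs)"
  using assms by (induction xs) auto

lemma map2_replicate_left:
  "map2 f (replicate (length ys) x) ys = map (f x) ys"
  by (induction ys) auto

text \<open>
  The \<open>s\<close>-th index set of the hyperminor is the set of values of \<open>\<sigma>\<^sub>s\<close> on block \<open>i\<close>, and since
  \<open>\<sigma>\<^sub>s\<close> increases there, its \<open>t\<close>-th smallest element is \<open>\<sigma>\<^sub>s((i - 1) * (p * d) + t)\<close>. Reindexing
  by sorted position is therefore composition with \<open>\<sigma>\<^sub>s\<close>.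
\<close>

lemma block_hyperminor_entry:
  assumes i: "i \<ge> 1" and h: "h \<in> {1..p}"
    and \<sigma>: "\<And>j. j \<in> {1..k} \<Longrightarrow> strict_mono_on {1..p * d} (\<lambda>t. \<sigma> j ((i - 1) * (p * d) + t))"
    and \<tau>: "\<And>j t. j \<in> {1..k} \<Longrightarrow> t \<in> {1..p * d} \<Longrightarrow> \<tau> j t \<in> {1..p * d}"
    and \<rho>: "\<And>j t. j \<in> {1..k} \<Longrightarrow> t \<in> {1..p * d} \<Longrightarrow>
      \<rho> j ((i - 1) * (p * d) + t) = \<sigma> j ((i - 1) * (p * d) + \<tau> j t)"
  shows "block_hyperminor d (p * d) k M (block_word k (p * d) \<sigma> i) (block_word k d \<tau> h) =
    M (block_word k d \<rho> ((i - 1) * p + h))"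
proof -
  let ?m = "p * d" and ?l = "block_word k (p * d) \<sigma> i"
  let ?pick = "\<lambda>I j. sorted_list_of_set I ! (j - 1)"
  let ?I = "\<lambda>s. (\<lambda>t. ?l ! (t - 1)) ` {(s - 1) * ?m + 1..s * ?m}"
  have I: "sorted_list_of_set (?I s) = map (\<lambda>t. \<sigma> s ((i - 1) * ?m + t)) [1..<?m + 1]" if s: "s \<in> {1..k}" for s
  proof -
    have "{(s - 1) * ?m + 1..s * ?m} = (\<lambda>t. (s - 1) * ?m + t) ` {1..?m}"
      using s by (cases s) (auto simp: image_add_atLeastAtMost add.commute)
    then have "?I s = (\<lambda>t. ?l ! ((s - 1) * ?m + t - 1)) ` {1..?m}"
      by (simp only: image_image)
    also have "\<dots> = (\<lambda>t. \<sigma> s ((i - 1) * ?m + t)) ` {1..?m}"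
      by (intro image_cong refl nth_block_word i s)
    finally show ?thesis
      using sorted_list_of_strict_mono_image[OF \<sigma>[OF s]] by simp
  qed
  have entry: "?pick (?I s) (\<tau> s ((h - 1) * d + u)) = \<rho> s (((i - 1) * p + h - 1) * d + u)"
    if s: "s \<in> {1..k}" and u: "u \<in> {1..d}" for s u
  proof -
    have t: "(h - 1) * d + u \<in> {1..?m}"
      using h u by (rule block_position_bounds)
    have "?pick (?I s) (\<tau> s ((h - 1) * d + u)) = \<sigma> s ((i - 1) * ?m + \<tau> s ((h - 1) * d + u))"
      unfolding I[OF s] by (rule nth_map_from_one[OF \<tau>[OF s t]])
    also have "\<dots> = \<rho> s ((i - 1) * ?m + ((h - 1) * d + u))"
      by (rule \<rho>[OF s t, symmetric])
    finally show ?thesis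
      using h by (simp add: sub_block_position del: One_nat_def)
  qed
  have "map2 ?pick (concat (map (\<lambda>s. replicate d (?I s)) [1..<k + 1])) (block_word k d \<tau> h) =
      concat (map (\<lambda>s. map2 ?pick (replicate d (?I s)) (map (\<lambda>u. \<tau> s ((h - 1) * d + u)) [1..<d + 1])) [1..<k + 1])"
    using h by (subst block_word_eq) (auto intro!: map2_concat simp del: upt_Suc)
  also have "\<dots> = concat (map (\<lambda>s. map (\<lambda>u. \<rho> s (((i - 1) * p + h - 1) * d + u)) [1..<d + 1]) [1..<k + 1])"
  proof (intro arg_cong[where f = concat] map_cong refl)
    fix s assume "s \<in> set [1..<k + 1]"
    then have s: "s \<in> {1..k}" by auto
    have "map2 ?pick (replicate d (?I s)) (map (\<lambda>u. \<tau> s ((h - 1) * d + u)) [1..<d + 1]) =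
        map (?pick (?I s)) (map (\<lambda>u. \<tau> s ((h - 1) * d + u)) [1..<d + 1])"
      using map2_replicate_left[of ?pick "map (\<lambda>u. \<tau> s ((h - 1) * d + u)) [1..<d + 1]" "?I s"]
      by (simp del: upt_Suc)
    also have "\<dots> = map (\<lambda>u. \<rho> s (((i - 1) * p + h - 1) * d + u)) [1..<d + 1]"
      unfolding map_map o_def by (rule map_cong[OF refl], rule entry[OF s]) auto
    finally show "map2 ?pick (replicate d (?I s)) (map (\<lambda>u. \<tau> s ((h - 1) * d + u)) [1..<d + 1]) =
      map (\<lambda>u. \<rho> s (((i - 1) * p + h - 1) * d + u)) [1..<d + 1]" .
  qed
  also have "\<dots> = block_word k d \<rho> ((i - 1) * p + h)"
    using h by (subst block_word_eq) auto
  finally show ?thesis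
    by (simp add: block_hyperminor_def hyperminor_def)
qed

lemma prod_block_positions:
  fixes f :: "nat \<Rightarrow> 'b::comm_monoid_mult"
  shows "(\<Prod>i=1..n. \<Prod>h=1..p. f ((i - 1) * p + h)) = (\<Prod>b=1..n * p. f b)"
proof (induction n)
  case (Suc n)
  have "(\<Prod>b=1..Suc n * p. f b) = (\<Prod>b=1..n * p. f b) * (\<Prod>b=n * p + 1..n * p + p. f b)"
    using prod.ub_add_nat[of 1 "n * p" f p] by (simp add: add.commute)
  also have "(\<Prod>b=n * p + 1..n * p + p. f b) = (\<Prod>h=1..p. f (n * p + h))"
    using prod.shift_bounds_cl_nat_ivl[of f 1 "n * p" p] by (simp add: add.commute)
  finally show ?case
    using Suc by simp
qed simp

text \<open>
  One summand of the outer hyperpfaffian, with one summand chosen in each of its \<open>n\<close> inner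
  hyperpfaffians, is the summand of the large hyperpfaffian at the composite permutations.
\<close>

lemma pfaffian_term_refinement:
  fixes M :: "'a::comm_ring_1 tensor"
  assumes \<sigma>: "\<sigma> \<in> {1..k} \<rightarrow>\<^sub>E block_increasing_perms (p * d) n"
    and \<tau>: "\<tau> \<in> {1..n} \<rightarrow>\<^sub>E ({1..k} \<rightarrow>\<^sub>E block_increasing_perms d p)"
  shows "(\<Prod>j=1..k. of_int (sign (\<sigma> j))) *
      (\<Prod>i=1..n. pfaffian_term d p k (block_hyperminor d (p * d) k M (block_word k (p * d) \<sigma> i)) (\<tau> i)) =
    pfaffian_term d (p * n) k M (\<lambda>j\<in>{1..k}. \<sigma> j \<circ> block_sum (p * d) (\<lambda>i\<in>{1..n}. \<tau> i j) n)"
proof -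
  let ?m = "p * d"
  let ?\<rho> = "\<lambda>j\<in>{1..k}. \<sigma> j \<circ> block_sum ?m (\<lambda>i\<in>{1..n}. \<tau> i j) n"
  have \<sigma>j: "\<sigma> j \<in> block_increasing_perms ?m n" if "j \<in> {1..k}" for j
    using \<sigma> that by (rule PiE_mem)
  have \<tau>ij: "\<tau> i j permutes {1..?m}" if "i \<in> {1..n}" "j \<in> {1..k}" for i j
    using PiE_mem[OF PiE_mem[OF \<tau> that(1)] that(2)] by (simp add: block_increasing_perms_iff mult.commute)
  have sign: "sign (?\<rho> j) = sign (\<sigma> j) * (\<Prod>i=1..n. sign (\<tau> i j))" if j: "j \<in> {1..k}" for j
  proof -
    have "permutation (\<sigma> j)"
      using \<sigma>j[OF j] by (auto simp: block_increasing_perms_iff intro: permutes_imp_permutation[rotated])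
    moreover have "permutation (block_sum ?m (\<lambda>i. \<tau> i j) n)"
      using block_sum_permutes[of n "\<lambda>i. \<tau> i j" ?m] \<tau>ij j by (intro permutes_imp_permutation) auto
    ultimately show ?thesis
      using j sign_block_sum[of n "\<lambda>i. \<tau> i j" ?m] \<tau>ij
      by (simp add: block_sum_restrict sign_compose del: One_nat_def)
  qed
  have entry: "block_hyperminor d ?m k M (block_word k ?m \<sigma> i) (block_word k d (\<tau> i) h) =
      M (block_word k d ?\<rho> ((i - 1) * p + h))" if i: "i \<in> {1..n}" and h: "h \<in> {1..p}" for i h
  proof (rule block_hyperminor_entry[OF _ h])
    show "strict_mono_on {1..?m} (\<lambda>t. \<sigma> j ((i - 1) * ?m + t))" if "j \<in> {1..k}" for j
      using \<sigma>j[OF that] i by (simp add: block_increasing_perms_iff)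
    show "\<tau> i j t \<in> {1..?m}" if "j \<in> {1..k}" "t \<in> {1..?m}" for j t
      using permutes_in_image[OF \<tau>ij[OF i that(1)]] that(2) by blast
    show "?\<rho> j ((i - 1) * ?m + t) = \<sigma> j ((i - 1) * ?m + \<tau> i j t)" if "j \<in> {1..k}" "t \<in> {1..?m}" for j t
      using block_sum_apply[of n "\<lambda>i. \<tau> i j" ?m i t] \<tau>ij i that
      by (simp add: block_sum_restrict del: One_nat_def)
  qed (use i in simp)
  have "(\<Prod>j=1..k. of_int (sign (\<sigma> j))) *
      (\<Prod>i=1..n. pfaffian_term d p k (block_hyperminor d ?m k M (block_word k ?m \<sigma> i)) (\<tau> i)) =
      ((\<Prod>j=1..k. of_int (sign (\<sigma> j))) * (\<Prod>i=1..n. \<Prod>j=1..k. of_int (sign (\<tau> i j)))) *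
      (\<Prod>i=1..n. \<Prod>h=1..p. M (block_word k d ?\<rho> ((i - 1) * p + h)))"
    by (simp only: pfaffian_term_def prod.distrib mult.assoc) (simp add: entry)
  also have "(\<Prod>j=1..k. of_int (sign (\<sigma> j))) * (\<Prod>i=1..n. \<Prod>j=1..k. of_int (sign (\<tau> i j))) =
      (\<Prod>j=1..k. of_int (sign (?\<rho> j)) :: 'a)"
    by (subst prod.swap) (simp add: prod.distrib[symmetric] sign del: restrict_apply One_nat_def)
  also have "(\<Prod>i=1..n. \<Prod>h=1..p. M (block_word k d ?\<rho> ((i - 1) * p + h))) =
      (\<Prod>b=1..p * n. M (block_word k d ?\<rho> b))"
    using prod_block_positions[of "\<lambda>b. M (block_word k d ?\<rho> b)" p n] by (simp only: mult.commute)
  finally show ?thesis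
    by (simp only: pfaffian_term_def)
qed

lemma (in comm_rat_algebra) scale_mult_right: "x * scale q y = scale q (x * y)"
  by (metis mult.commute scale_mult_left)

lemma (in comm_rat_algebra) prod_scale:
  "(\<Prod>i\<in>I. scale q (f i)) = scale (q ^ card I) (\<Prod>i\<in>I. f i)"
proof (induction I rule: infinite_finite_induct)
  case (insert i I)
  then show ?case
    by (simp add: scale_mult_right scale_mult_left[symmetric] mult.commute)
qed auto

theorem proposition3p2:
  fixes scale :: "rat \<Rightarrow> 'a::comm_ring_1 \<Rightarrow> 'a"
    and M :: "'a tensor"
    and n k p m' m :: nat
  assumes "comm_rat_algebra scale"
    and "n \<ge> 1" and "k \<ge> 1" and "p \<ge> 1" and "m' \<ge> 1"
    and "even (m' * k)"
    and "m = p * m'"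
  shows "hyperpfaffian scale m n k (\<lambda>l. hyperpfaffian scale m' p k (block_hyperminor m' m k M l)) =
    scale (1 / fact n * (fact (n * p) / fact p ^ n)) (hyperpfaffian scale m' (p * n) k M)"
proof -
  interpret comm_rat_algebra scale by fact
  let ?S = "{1..k} \<rightarrow>\<^sub>E block_increasing_perms m n"
  let ?B = "{1..k} \<rightarrow>\<^sub>E block_increasing_perms m' p"
  let ?T = "{1..n} \<rightarrow>\<^sub>E ?B"
  let ?R = "{1..k} \<rightarrow>\<^sub>E block_increasing_perms m' (p * n)"
  let ?\<Phi> = "\<lambda>(\<sigma>, \<tau>). \<lambda>j\<in>{1..k}. \<sigma> j \<circ> block_sum m (\<lambda>i\<in>{1..n}. \<tau> i j) n"
  let ?inner = "\<lambda>\<sigma> i. pfaffian_term m' p k (block_hyperminor m' m k M (block_word k m \<sigma> i))"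
  let ?H = "\<lambda>l. hyperpfaffian scale m' p k (block_hyperminor m' m k M l)"
  let ?sgn = "\<lambda>\<sigma>. \<Prod>j=1..k. of_int (sign (\<sigma> j)) :: 'a"
  have finB: "finite ?B"
    by (simp add: finite_PiE finite_block_increasing_perms)
  have bij: "bij_betw ?\<Phi> (?S \<times> ?T) ?R"
    using bij_betw_tuples_of_families[where J = "{1..k}", OF bij_betw_block_refinement[of p m' n]]
    by (simp only: assms(7) prod.case)
  have expand: "pfaffian_term m n k ?H \<sigma> =
      scale ((1 / fact p) ^ n) (\<Sum>\<tau>\<in>?T. pfaffian_term m' (p * n) k M (?\<Phi> (\<sigma>, \<tau>)))"
    if \<sigma>: "\<sigma> \<in> ?S" for \<sigma>
  proof -
    have "pfaffian_term m n k ?H \<sigma> = ?sgn \<sigma> * (\<Prod>i=1..n. scale (1 / fact p) (\<Sum>\<tau>\<in>?B. ?inner \<sigma> i \<tau>))"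
      by (simp only: pfaffian_term_def[of m n] hyperpfaffian_eq_sum_terms)
    also have "\<dots> = ?sgn \<sigma> * scale ((1 / fact p) ^ n) (\<Prod>i=1..n. \<Sum>\<tau>\<in>?B. ?inner \<sigma> i \<tau>)"
      by (simp add: prod_scale)
    also have "\<dots> = scale ((1 / fact p) ^ n) (?sgn \<sigma> * (\<Prod>i=1..n. \<Sum>\<tau>\<in>?B. ?inner \<sigma> i \<tau>))"
      by (rule scale_mult_right)
    also have "(\<Prod>i=1..n. \<Sum>\<tau>\<in>?B. ?inner \<sigma> i \<tau>) = (\<Sum>\<tau>\<in>?T. \<Prod>i=1..n. ?inner \<sigma> i (\<tau> i))"
      using finB by (intro prod_sum_PiE) auto
    also have "?sgn \<sigma> * \<dots> = (\<Sum>\<tau>\<in>?T. pfaffian_term m' (p * n) k M (?\<Phi> (\<sigma>, \<tau>)))"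
      unfolding sum_distrib_left prod.case
      using pfaffian_term_refinement[OF \<sigma>[unfolded assms(7)], of _ M]
      by (intro sum.cong refl) (simp only: assms(7))
    finally show ?thesis .
  qed
  have "(\<Sum>\<sigma>\<in>?S. pfaffian_term m n k ?H \<sigma>) =
      scale ((1 / fact p) ^ n) (\<Sum>\<sigma>\<in>?S. \<Sum>\<tau>\<in>?T. pfaffian_term m' (p * n) k M (?\<Phi> (\<sigma>, \<tau>)))"
    unfolding scale_sum_right by (intro sum.cong refl) (simp only: expand scale_sum_right)
  also have "(\<Sum>\<sigma>\<in>?S. \<Sum>\<tau>\<in>?T. pfaffian_term m' (p * n) k M (?\<Phi> (\<sigma>, \<tau>))) =
      (\<Sum>x\<in>?S \<times> ?T. pfaffian_term m' (p * n) k M (?\<Phi> x))"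
    unfolding sum.cartesian_product by (intro sum.cong refl) (simp only: split_beta prod.collapse)
  also have "\<dots> = (\<Sum>\<rho>\<in>?R. pfaffian_term m' (p * n) k M \<rho>)"
    by (rule sum.reindex_bij_betw[OF bij])
  finally have "hyperpfaffian scale m n k ?H =
      scale (1 / fact n * (1 / fact p) ^ n) (\<Sum>\<rho>\<in>?R. pfaffian_term m' (p * n) k M \<rho>)"
    by (simp only: hyperpfaffian_eq_sum_terms[of scale m n] scale_scale)
  \<comment> \<open>The factor \<open>1 / (p * n)!\<close> of the large hyperpfaffian absorbs the numerator of the multinomial coefficient.\<close>
  also have "1 / fact n * (1 / fact p) ^ n =
      1 / fact n * (fact (n * p) / fact p ^ n) * (1 / fact (p * n) :: rat)"
    by (simp add: power_one_over mult.commute)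
  finally show ?thesis
    by (simp only: hyperpfaffian_eq_sum_terms[of scale m' "p * n"] scale_scale)
qed

end
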